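(* Let $\alpha: I\to E_1^3$ be a unit speed non-lightlike Frenet curve with Frenet frame $\{T,N,B\}$ and torsion $\tau$, and let $\beta: I\to E_1^3$ be an $X$-direction curve of $\alpha$, where $X=uT+vN+wB$ is a unit non-lightlike vector field along $\alpha$. Then $\beta$ is an evolute-direction curve of $\alpha$ if and only if the following hold: (i) $u(s)=0,\ v(s)=-\cos\left(\int\tau\,ds\right),\ w(s)=\sin\left(\int\tau\,ds\right)$, if $\alpha$ is a timelike curve and $X$ is a spacelike vector field; (ii) $u(s)=0,\ v(s)=-\cosh\left(\int\tau\,ds\right),\ w(s)=\sinh\left(\int\tau\,ds\right)$, if $\alpha$ is a spacelike curve of type 1 (respectively, type 2) and $X$ is timelike (respectively, spacelike); (iii) $u(s)=0,\ v(s)=\sinh\left(\int\tau\,ds\right),\ w(s)=-\cosh\left(\int\tau\,ds\right)$, if $\alpha$ is a spacelike curve of type 1 (respectively, type 2) and $X$ is spacelike (respectively, timelike).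
   Context: $E_1^3$ is $\mathbb{R}^3$ with the metric $\langle x,y\rangle=-x_1y_1+x_2y_2+x_3y_3$ and the Lorentz vector product $x\times y=(x_2y_3-x_3y_2,\ x_1y_3-x_3y_1,\ x_2y_1-x_1y_2)$. A vector $x$ is spacelike if $\langle x,x\rangle>0$ or $x=0$, timelike if $\langle x,x\rangle<0$, lightlike if $\langle x,x\rangle=0$ and $x\ne0$. A curve is timelike (spacelike) if all its velocity vectors are; non-lightlike means timelike or spacelike; unit speed means $|\langle\alpha',\alpha'\rangle|=1$. All functions are as differentiable as needed. A unit speed non-lightlike curve $\alpha(s)$ has Frenet frame $\{T,N,B\}$ (orthonormal, non-lightlike vectors, $T=\alpha'$), curvature $\kappa$ and torsion $\tau$ with $T'=\kappa N,\ N'=\varepsilon_B\kappa T+\tau B,\ B'=\varepsilon_T\tau N$, where $\varepsilon_Y=\langle Y,Y\rangle=\pm1$ and $\varepsilon_B=-\varepsilon_T\varepsilon_N$; the frame satisfies $B=\varepsilon_T\varepsilon_N T\times N$, $N=\varepsilon_B\varepsilon_T B\times T$, $T=\varepsilon_N\varepsilon_B N\times B$. It is a Frenet curve if $\kappa\neq0$. A spacelike curve is of type 1 if $N$ is timelike (and $T,B$ spacelike), of type 2 if $B$ is timelike (and $T,N$ spacelike). Let $X(s)=u(s)T(s)+v(s)N(s)+w(s)B(s)$ with $u,v,w$ differentiable and $\varepsilon_Tu^2+\varepsilon_Nv^2+\varepsilon_Bw^2=\pm1$ (constant sign). An $X$-direction curve of $\alpha$ is a curve $\beta$ whose tangent is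 $\overline T=X$ (an integral curve of $X$); $s$ is also arc-length for $\beta$. The Frenet frame, curvature and torsion of $\beta$ are $\{\overline T,\overline N,\overline B\},\overline\kappa,\overline\tau$, with $\overline\kappa\ne0$. $\beta$ is called an evolute-direction curve of $\alpha$ if $\beta$ is an $X$-direction curve of $\alpha$ and is an evolute of $\alpha$, which means $\langle\overline T,T\rangle=0$ and $\overline N=T$ along the curves. $\int\tau\,ds$ denotes an indefinite integral (an antiderivative of $\tau$, with a choice of additive constant).
   Formalization: In (ii) and (iii), v and w are given up to a common constant sign ±1, since the printed "only if" fails (α=(cosh s, sinh s, 0), X=N gives v=1); "N̄=T" is required for one of the two orientations of the Frenet frame of β. *)

theory Defs
  imports "HOL-Analysis.Analysis"
begin

definition lorentz_inner :: "real^3 \<Rightarrow> real^3 \<Rightarrow> real" where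
  "lorentz_inner x y = - (x$1 * y$1) + x$2 * y$2 + x$3 * y$3"

definition lorentz_cross :: "real^3 \<Rightarrow> real^3 \<Rightarrow> real^3" where
  "lorentz_cross x y =
     vector [x$2 * y$3 - x$3 * y$2, x$1 * y$3 - x$3 * y$1, x$2 * y$1 - x$1 * y$2]"

definition spacelike :: "real^3 \<Rightarrow> bool" where
  "spacelike x \<longleftrightarrow> lorentz_inner x x > 0 \<or> x = 0"

definition timelike :: "real^3 \<Rightarrow> bool" where
  "timelike x \<longleftrightarrow> lorentz_inner x x < 0"

text \<open>
  Curves are functions on the real line that are only considered on an interval \<open>I\<close>;
  derivatives are taken within \<open>I\<close>, so \<open>I\<close> may or may not contain its end points.
\<close>

definition velocity :: "real set \<Rightarrow> (real \<Rightarrow> real^3) \<Rightarrow> real \<Rightarrow> real^3" where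
  "velocity I \<alpha> s = vector_derivative \<alpha> (at s within I)"

definition differentiable_curve :: "real set \<Rightarrow> (real \<Rightarrow> real^3) \<Rightarrow> bool" where
  "differentiable_curve I \<alpha> \<longleftrightarrow> (\<forall>s\<in>I. \<alpha> differentiable (at s within I))"

definition timelike_curve :: "real set \<Rightarrow> (real \<Rightarrow> real^3) \<Rightarrow> bool" where
  "timelike_curve I \<alpha> \<longleftrightarrow> differentiable_curve I \<alpha> \<and> (\<forall>s\<in>I. timelike (velocity I \<alpha> s))"

definition spacelike_curve :: "real set \<Rightarrow> (real \<Rightarrow> real^3) \<Rightarrow> bool" where
  "spacelike_curve I \<alpha> \<longleftrightarrow> differentiable_curve I \<alpha> \<and> (\<forall>s\<in>I. spacelike (velocity I \<alpha> s))"

definition non_lightlike_curve :: "real set \<Rightarrow> (real \<Rightarrow> real^3) \<Rightarrow> bool" where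
  "non_lightlike_curve I \<alpha> \<longleftrightarrow> timelike_curve I \<alpha> \<or> spacelike_curve I \<alpha>"

definition unit_speed :: "real set \<Rightarrow> (real \<Rightarrow> real^3) \<Rightarrow> bool" where
  "unit_speed I \<alpha> \<longleftrightarrow> differentiable_curve I \<alpha> \<and>
     (\<forall>s\<in>I. \<bar>lorentz_inner (velocity I \<alpha> s) (velocity I \<alpha> s)\<bar> = 1)"

definition causal_sign :: "real^3 \<Rightarrow> real" where
  "causal_sign x = lorentz_inner x x"

definition orthonormal_frame :: "real^3 \<Rightarrow> real^3 \<Rightarrow> real^3 \<Rightarrow> bool" where
  "orthonormal_frame t n b \<longleftrightarrow>
     lorentz_inner t n = 0 \<and> lorentz_inner t b = 0 \<and> lorentz_inner n b = 0 \<and>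
     \<bar>causal_sign t\<bar> = 1 \<and> \<bar>causal_sign n\<bar> = 1 \<and> \<bar>causal_sign b\<bar> = 1 \<and>
     causal_sign b = - causal_sign t * causal_sign n \<and>
     b = (causal_sign t * causal_sign n) *\<^sub>R lorentz_cross t n \<and>
     n = (causal_sign b * causal_sign t) *\<^sub>R lorentz_cross b t \<and>
     t = (causal_sign n * causal_sign b) *\<^sub>R lorentz_cross n b"

text \<open>
  The curvature is not required to be positive.  Hence, when \<open>\<kappa>\<close> has no zeros, the Frenet
  apparatus of a curve is determined only up to the simultaneous change of
  \<open>N, B, \<kappa>\<close> into \<open>- N, - B, - \<kappa>\<close>, which keeps \<open>T\<close> and \<open>\<tau>\<close>; under it the
  components \<open>v, w\<close> of a vector field change sign.  Continuity of \<open>\<kappa>\<close> and \<open>\<tau>\<close> says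
  that the frame is continuously differentiable.
\<close>

definition frenet_apparatus ::
  "real set \<Rightarrow> (real \<Rightarrow> real^3) \<Rightarrow> (real \<Rightarrow> real^3) \<Rightarrow> (real \<Rightarrow> real^3) \<Rightarrow> (real \<Rightarrow> real^3) \<Rightarrow>
   (real \<Rightarrow> real) \<Rightarrow> (real \<Rightarrow> real) \<Rightarrow> bool" where
  "frenet_apparatus I \<alpha> T N B \<kappa> \<tau> \<longleftrightarrow>
     unit_speed I \<alpha> \<and> non_lightlike_curve I \<alpha> \<and>
     continuous_on I \<kappa> \<and> continuous_on I \<tau> \<and>
     (\<forall>s\<in>I. T s = velocity I \<alpha> s \<and> orthonormal_frame (T s) (N s) (B s) \<and>
        (T has_vector_derivative \<kappa> s *\<^sub>R N s) (at s within I) \<and>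
        (N has_vector_derivative (causal_sign (B s) * \<kappa> s) *\<^sub>R T s + \<tau> s *\<^sub>R B s) (at s within I) \<and>
        (B has_vector_derivative (causal_sign (T s) * \<tau> s) *\<^sub>R N s) (at s within I))"

definition frenet_curve_with ::
  "real set \<Rightarrow> (real \<Rightarrow> real^3) \<Rightarrow> (real \<Rightarrow> real^3) \<Rightarrow> (real \<Rightarrow> real^3) \<Rightarrow> (real \<Rightarrow> real^3) \<Rightarrow>
   (real \<Rightarrow> real) \<Rightarrow> (real \<Rightarrow> real) \<Rightarrow> bool" where
  "frenet_curve_with I \<alpha> T N B \<kappa> \<tau> \<longleftrightarrow>
     frenet_apparatus I \<alpha> T N B \<kappa> \<tau> \<and> (\<forall>s\<in>I. \<kappa> s \<noteq> 0)"

definition frenet_curve :: "real set \<Rightarrow> (real \<Rightarrow> real^3) \<Rightarrow> bool" where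
  "frenet_curve I \<alpha> \<longleftrightarrow> (\<exists>T N B \<kappa> \<tau>. frenet_curve_with I \<alpha> T N B \<kappa> \<tau>)"

definition spacelike_type1 ::
  "real set \<Rightarrow> (real \<Rightarrow> real^3) \<Rightarrow> (real \<Rightarrow> real^3) \<Rightarrow> (real \<Rightarrow> real^3) \<Rightarrow> (real \<Rightarrow> real^3) \<Rightarrow> bool" where
  "spacelike_type1 I \<alpha> T N B \<longleftrightarrow> spacelike_curve I \<alpha> \<and>
     (\<forall>s\<in>I. timelike (N s) \<and> spacelike (T s) \<and> spacelike (B s))"

definition spacelike_type2 ::
  "real set \<Rightarrow> (real \<Rightarrow> real^3) \<Rightarrow> (real \<Rightarrow> real^3) \<Rightarrow> (real \<Rightarrow> real^3) \<Rightarrow> (real \<Rightarrow> real^3) \<Rightarrow> bool" where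
  "spacelike_type2 I \<alpha> T N B \<longleftrightarrow> spacelike_curve I \<alpha> \<and>
     (\<forall>s\<in>I. timelike (B s) \<and> spacelike (T s) \<and> spacelike (N s))"

definition spacelike_field :: "real set \<Rightarrow> (real \<Rightarrow> real^3) \<Rightarrow> bool" where
  "spacelike_field I X \<longleftrightarrow> (\<forall>s\<in>I. spacelike (X s))"

definition timelike_field :: "real set \<Rightarrow> (real \<Rightarrow> real^3) \<Rightarrow> bool" where
  "timelike_field I X \<longleftrightarrow> (\<forall>s\<in>I. timelike (X s))"

definition unit_field_along ::
  "real set \<Rightarrow> (real \<Rightarrow> real^3) \<Rightarrow> (real \<Rightarrow> real^3) \<Rightarrow> (real \<Rightarrow> real^3) \<Rightarrow>
   (real \<Rightarrow> real) \<Rightarrow> (real \<Rightarrow> real) \<Rightarrow> (real \<Rightarrow> real) \<Rightarrow> (real \<Rightarrow> real^3) \<Rightarrow> bool" where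
  "unit_field_along I T N B u v w X \<longleftrightarrow>
     u differentiable_on I \<and> v differentiable_on I \<and> w differentiable_on I \<and>
     (\<forall>s\<in>I. X s = u s *\<^sub>R T s + v s *\<^sub>R N s + w s *\<^sub>R B s) \<and>
     (\<exists>e\<in>{1, -1}. \<forall>s\<in>I. causal_sign (T s) * (u s)\<^sup>2 + causal_sign (N s) * (v s)\<^sup>2
                          + causal_sign (B s) * (w s)\<^sup>2 = e)"

definition direction_curve ::
  "real set \<Rightarrow> (real \<Rightarrow> real^3) \<Rightarrow> (real \<Rightarrow> real^3) \<Rightarrow> bool" where
  "direction_curve I X \<beta> \<longleftrightarrow> (\<forall>s\<in>I. (\<beta> has_vector_derivative X s) (at s within I))"

text \<open>
  Being an evolute is a property of the two curves: the condition on the principal normal of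
  \<open>\<beta>\<close> is meant for one of the two orientations of its Frenet frame.
\<close>

definition evolute_of :: "real set \<Rightarrow> (real \<Rightarrow> real^3) \<Rightarrow> (real \<Rightarrow> real^3) \<Rightarrow> bool" where
  "evolute_of I \<alpha> \<beta> \<longleftrightarrow>
     (\<exists>T N B \<kappa> \<tau> T' N' B' \<kappa>' \<tau>'.
        frenet_curve_with I \<alpha> T N B \<kappa> \<tau> \<and> frenet_curve_with I \<beta> T' N' B' \<kappa>' \<tau>' \<and>
        (\<forall>s\<in>I. lorentz_inner (T' s) (T s) = 0 \<and> N' s = T s))"

definition evolute_direction_curve ::
  "real set \<Rightarrow> (real \<Rightarrow> real^3) \<Rightarrow> (real \<Rightarrow> real^3) \<Rightarrow> (real \<Rightarrow> real^3) \<Rightarrow> bool" where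
  "evolute_direction_curve I \<alpha> X \<beta> \<longleftrightarrow> direction_curve I X \<beta> \<and> evolute_of I \<alpha> \<beta>"

definition antiderivative_on :: "real set \<Rightarrow> (real \<Rightarrow> real) \<Rightarrow> (real \<Rightarrow> real) \<Rightarrow> bool" where
  "antiderivative_on I f F \<longleftrightarrow> (\<forall>s\<in>I. (F has_real_derivative f s) (at s within I))"

end

(*
  An evolute-direction curve is characterised by X' being parallel to T with u = 0.  Since
  X' = (eps_B v kappa) T + (v' + eps_T tau w) N + (w' + tau v) B for X = v N + w B, this is the
  linear system v' = - eps_T tau w, w' = - tau v, and non-vanishing curvature of beta makes v
  non-zero.  The constancy of eps_N v^2 + eps_B w^2 confines (v, w) to a circle or a hyperbola.
  The angle along it is read off as arcsin w or arsinh (+-w), on branches that do not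
  change because v (or, when the case is hyperbolic and X has the causal character of B, w) keeps its sign; the system
  makes that angle an antiderivative of tau.
*)

theory Submission
  imports Defs
begin

section \<open>Lorentzian linear algebra and orthonormal frames\<close>

lemma lorentz_inner_commute: "lorentz_inner x y = lorentz_inner y x"
  by (simp add: lorentz_inner_def algebra_simps)

lemma lorentz_inner_add_left: "lorentz_inner (x + y) z = lorentz_inner x z + lorentz_inner y z"
  by (simp add: lorentz_inner_def algebra_simps)

lemma lorentz_inner_add_right: "lorentz_inner z (x + y) = lorentz_inner z x + lorentz_inner z y"
  by (simp add: lorentz_inner_def algebra_simps)

lemma lorentz_inner_scaleR_left: "lorentz_inner (c *\<^sub>R x) y = c * lorentz_inner x y"
  by (simp add: lorentz_inner_def algebra_simps)

lemma lorentz_inner_scaleR_right: "lorentz_inner x (c *\<^sub>R y) = c * lorentz_inner x y"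
  by (simp add: lorentz_inner_def algebra_simps)

lemmas lorentz_inner_linear = lorentz_inner_add_left lorentz_inner_add_right
  lorentz_inner_scaleR_left lorentz_inner_scaleR_right

lemma lorentz_inner_0_left [simp]: "lorentz_inner 0 y = 0"
  by (simp add: lorentz_inner_def)

lemma causal_sign_uminus [simp]: "causal_sign (- x) = causal_sign x"
  by (simp add: causal_sign_def lorentz_inner_def)

text \<open>Orthogonality would make \<open>x$1 * y$1\<close> equal to the Euclidean product of the
  last two coordinates, but Cauchy-Schwarz there, together with timelikeness of both vectors, forces
  that product to be strictly smaller in absolute value.\<close>

lemma timelike_not_orthogonal:
  assumes "timelike x" and "timelike y"
  shows "lorentz_inner x y \<noteq> 0"
proof
  assume "lorentz_inner x y = 0"
  then have eq: "x$1 * y$1 = x$2 * y$2 + x$3 * y$3"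
    by (simp add: lorentz_inner_def)
  have x: "(x$2)\<^sup>2 + (x$3)\<^sup>2 < (x$1)\<^sup>2" and y: "(y$2)\<^sup>2 + (y$3)\<^sup>2 < (y$1)\<^sup>2"
    using assms by (simp_all add: timelike_def lorentz_inner_def power2_eq_square)
  \<comment> \<open>Lagrange's identity in the plane of the last two coordinates.\<close>
  have "(x$1 * y$1)\<^sup>2 = ((x$2)\<^sup>2 + (x$3)\<^sup>2) * ((y$2)\<^sup>2 + (y$3)\<^sup>2) - (x$2 * y$3 - x$3 * y$2)\<^sup>2"
    unfolding eq by algebra
  also have "\<dots> \<le> ((x$2)\<^sup>2 + (x$3)\<^sup>2) * ((y$2)\<^sup>2 + (y$3)\<^sup>2)"
    by simp
  also have "\<dots> < (x$1)\<^sup>2 * (y$1)\<^sup>2"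
    using x y by (intro mult_strict_mono') auto
  finally show False
    by (simp add: power_mult_distrib)
qed

lemma orthonormal_frameD:
  assumes "orthonormal_frame t n b"
  shows "lorentz_inner t n = 0" and "lorentz_inner t b = 0" and "lorentz_inner n b = 0"
    and "lorentz_inner n t = 0" and "lorentz_inner b t = 0" and "lorentz_inner b n = 0"
    and "\<bar>causal_sign t\<bar> = 1" and "\<bar>causal_sign n\<bar> = 1" and "\<bar>causal_sign b\<bar> = 1"
    and "causal_sign b = - causal_sign t * causal_sign n"
proof -
  show 1: "lorentz_inner t n = 0" "lorentz_inner t b = 0" "lorentz_inner n b = 0"
    "\<bar>causal_sign t\<bar> = 1" "\<bar>causal_sign n\<bar> = 1" "\<bar>causal_sign b\<bar> = 1"
    "causal_sign b = - causal_sign t * causal_sign n"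
    using assms unfolding orthonormal_frame_def by blast+
  show "lorentz_inner n t = 0" "lorentz_inner b t = 0" "lorentz_inner b n = 0"
    using 1(1-3) by (simp_all add: lorentz_inner_commute)
qed

text \<open>Pairing with each frame vector isolates one coefficient, multiplied by a causal sign,
  which is nonzero. This allows coefficients of X' to be compared.\<close>

lemma orthonormal_frame_independent:
  assumes "orthonormal_frame t n b"
    and "a *\<^sub>R t + c *\<^sub>R n + d *\<^sub>R b = a' *\<^sub>R t + c' *\<^sub>R n + d' *\<^sub>R b"
  shows "a = a'" and "c = c'" and "d = d'"
proof -
  note orth = orthonormal_frameD[OF assms(1)]
  have nz: "lorentz_inner t t \<noteq> 0" "lorentz_inner n n \<noteq> 0" "lorentz_inner b b \<noteq> 0"
    using orth(7-9) by (auto simp: causal_sign_def)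
  have "lorentz_inner (a *\<^sub>R t + c *\<^sub>R n + d *\<^sub>R b) z
      = lorentz_inner (a' *\<^sub>R t + c' *\<^sub>R n + d' *\<^sub>R b) z" for z
    using assms(2) by simp
  from this[of t] this[of n] this[of b] show "a = a'" "c = c'" "d = d'"
    using orth(1-6) nz by (simp_all add: lorentz_inner_linear)
qed

lemma lorentz_cross_uminus:
  "lorentz_cross (- x) y = - lorentz_cross x y" "lorentz_cross x (- y) = - lorentz_cross x y"
  by (simp_all add: lorentz_cross_def vec_eq_iff forall_3)

lemma lorentz_inner_uminus:
  "lorentz_inner (- x) y = - lorentz_inner x y" "lorentz_inner x (- y) = - lorentz_inner x y"
  by (simp_all add: lorentz_inner_def)

text \<open>Causal signs are quadratic, hence unchanged. Of the three cross products, those defining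
  \<open>b\<close> and \<open>n\<close> change sign once, the one defining \<open>t\<close>
  twice.\<close>

lemma orthonormal_frame_flip:
  "orthonormal_frame t n b \<Longrightarrow> orthonormal_frame t (- n) (- b)"
  unfolding orthonormal_frame_def lorentz_cross_uminus lorentz_inner_uminus causal_sign_uminus
    scaleR_minus_right neg_equal_iff_equal minus_minus neg_equal_0_iff_equal
  by blast

section \<open>Frenet apparatus and reversal of its orientation\<close>

lemma frenet_apparatusD:
  assumes "frenet_apparatus I \<alpha> T N B \<kappa> \<tau>" and "s \<in> I"
  shows "T s = velocity I \<alpha> s" and "orthonormal_frame (T s) (N s) (B s)"
    and "(T has_vector_derivative \<kappa> s *\<^sub>R N s) (at s within I)"
    and "(N has_vector_derivative (causal_sign (B s) * \<kappa> s) *\<^sub>R T s + \<tau> s *\<^sub>R B s) (at s within I)"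
    and "(B has_vector_derivative (causal_sign (T s) * \<tau> s) *\<^sub>R N s) (at s within I)"
  using assms unfolding frenet_apparatus_def by blast+

lemma frenet_curve_withD:
  assumes "frenet_curve_with I \<alpha> T N B \<kappa> \<tau>"
  shows "frenet_apparatus I \<alpha> T N B \<kappa> \<tau>" and "s \<in> I \<Longrightarrow> \<kappa> s \<noteq> 0"
  using assms by (simp_all add: frenet_curve_with_def)

text \<open>Serves to reverse the frame of \<beta> when its principal normal comes out as -T instead
  of T.\<close>

lemma frenet_curve_with_flip:
  assumes "frenet_curve_with I \<alpha> T N B \<kappa> \<tau>"
  shows "frenet_curve_with I \<alpha> T (\<lambda>s. - N s) (\<lambda>s. - B s) (\<lambda>s. - \<kappa> s) \<tau>"
proof -
  note fr = frenet_curve_withD(1)[OF assms]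
  have "T s = velocity I \<alpha> s \<and> orthonormal_frame (T s) (- N s) (- B s) \<and>
      (T has_vector_derivative - \<kappa> s *\<^sub>R - N s) (at s within I) \<and>
      ((\<lambda>s. - N s) has_vector_derivative
        (causal_sign (- B s) * - \<kappa> s) *\<^sub>R T s + \<tau> s *\<^sub>R - B s) (at s within I) \<and>
      ((\<lambda>s. - B s) has_vector_derivative (causal_sign (T s) * \<tau> s) *\<^sub>R - N s) (at s within I)"
    if "s \<in> I" for s
    using frenet_apparatusD(1,3)[OF fr that]
      orthonormal_frame_flip[OF frenet_apparatusD(2)[OF fr that]]
      has_vector_derivative_minus[OF frenet_apparatusD(4)[OF fr that]]
      has_vector_derivative_minus[OF frenet_apparatusD(5)[OF fr that]]
    by simp
  moreover have "unit_speed I \<alpha>" "non_lightlike_curve I \<alpha>"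
    "continuous_on I (\<lambda>s. - \<kappa> s)" "continuous_on I \<tau>" "\<forall>s\<in>I. - \<kappa> s \<noteq> 0"
    using assms by (auto simp: frenet_curve_with_def frenet_apparatus_def intro: continuous_intros)
  ultimately show ?thesis
    unfolding frenet_curve_with_def frenet_apparatus_def by blast
qed

section \<open>Constancy of signs and the causal types of a curve\<close>

lemma connected_nonzero_constant_sign:
  fixes f :: "real \<Rightarrow> real"
  assumes "connected S" and "continuous_on S f" and "\<And>s. s \<in> S \<Longrightarrow> f s \<noteq> 0"
  shows "(\<forall>s\<in>S. f s > 0) \<or> (\<forall>s\<in>S. f s < 0)"
proof (rule ccontr)
  assume "\<not> ?thesis"
  then obtain a b where "a \<in> S" "b \<in> S" "f a \<le> 0" "0 \<le> f b"
    by (auto simp: not_less)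
  moreover have "connected (f ` S)"
    using assms by (intro connected_continuous_image)
  ultimately have "0 \<in> f ` S"
    using connectedD_interval by blast
  with assms(3) show False
    by auto
qed

lemma connected_unit_constant:
  fixes f :: "real \<Rightarrow> real"
  assumes "connected S" and "continuous_on S f" and "\<And>s. s \<in> S \<Longrightarrow> \<bar>f s\<bar> = 1"
  shows "(\<forall>s\<in>S. f s = 1) \<or> (\<forall>s\<in>S. f s = - 1)"
proof -
  have "f s \<noteq> 0" if "s \<in> S" for s
    using assms(3)[OF that] by auto
  then show ?thesis
    using connected_nonzero_constant_sign[OF assms(1,2)] assms(3) by (smt (verit))
qed

text \<open>Derivatives within I are unique at limit points of I. An interval with nonempty interior
  is connected and not a single point, so it has no isolated points.\<close>

lemma interval_at_within_neq_bot:
  fixes I :: "real set"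
  assumes "is_interval I" and "interior I \<noteq> {}" and "s \<in> I"
  shows "at s within I \<noteq> bot"
proof -
  have "I \<noteq> {s}"
    using assms(2) by auto
  then have "s islimpt I"
    using assms by (intro connected_imp_perfect) (auto simp: is_interval_connected_1)
  then show ?thesis
    by (simp add: trivial_limit_within)
qed

lemma continuous_on_causal_sign:
  "continuous_on S Y \<Longrightarrow> continuous_on S (\<lambda>s. causal_sign (Y s))"
  unfolding causal_sign_def lorentz_inner_def by (intro continuous_intros)

text \<open>The sign of T is given by the causal character of the curve, that of N is constant
  because N is continuous with values of square norm 1 or -1, and that of B is minus their
  product.\<close>

lemma frenet_apparatus_cases:
  assumes "is_interval I" and frenet: "frenet_apparatus I \<alpha> T N B \<kappa> \<tau>"
  obtains
    (timelike) "timelike_curve I \<alpha>"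
      "\<And>s. s \<in> I \<Longrightarrow> causal_sign (T s) = - 1 \<and> causal_sign (N s) = 1 \<and> causal_sign (B s) = 1"
  | (type1) "spacelike_type1 I \<alpha> T N B"
      "\<And>s. s \<in> I \<Longrightarrow> causal_sign (T s) = 1 \<and> causal_sign (N s) = - 1 \<and> causal_sign (B s) = 1"
  | (type2) "spacelike_type2 I \<alpha> T N B"
      "\<And>s. s \<in> I \<Longrightarrow> causal_sign (T s) = 1 \<and> causal_sign (N s) = 1 \<and> causal_sign (B s) = - 1"
proof -
  have frame: "orthonormal_frame (T s) (N s) (B s)" "T s = velocity I \<alpha> s" if "s \<in> I" for s
    using frenet_apparatusD(1,2)[OF frenet that] by simp_all
  have B: "causal_sign (B s) = - causal_sign (T s) * causal_sign (N s)"
    and unit: "\<bar>causal_sign (T s)\<bar> = 1" "\<bar>causal_sign (N s)\<bar> = 1" if "s \<in> I" for s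
    using orthonormal_frameD[OF frame(1)[OF that]] by simp_all
  have "continuous_on I N"
    using frenet_apparatusD(4)[OF frenet] has_vector_derivative_continuous
    unfolding continuous_on_eq_continuous_within by blast
  then have N: "(\<forall>s\<in>I. causal_sign (N s) = 1) \<or> (\<forall>s\<in>I. causal_sign (N s) = - 1)"
    using assms(1) unit(2)
    by (intro connected_unit_constant continuous_on_causal_sign)
      (auto simp: is_interval_connected_1)
  consider "timelike_curve I \<alpha>" | "spacelike_curve I \<alpha>"
    using frenet by (auto simp: frenet_apparatus_def non_lightlike_curve_def)
  then show thesis
  proof cases
    case 1
    have T: "causal_sign (T s) = - 1" if "s \<in> I" for s
      using 1 unit(1)[OF that] frame(2)[OF that] that
      by (auto simp: timelike_curve_def timelike_def causal_sign_def)
    have "causal_sign (N s) = 1" if "s \<in> I" for s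
    \<comment> \<open>A frame whose T is timelike cannot contain a second timelike vector orthogonal
      to T.\<close>
    proof (rule ccontr)
      assume "causal_sign (N s) \<noteq> 1"
      then have "timelike (N s)" "timelike (T s)"
        using unit(2)[OF that] T[OF that] by (auto simp: timelike_def causal_sign_def)
      with timelike_not_orthogonal show False
        using orthonormal_frameD(1)[OF frame(1)[OF that]] by blast
    qed
    with 1 T B show thesis
      by (intro timelike) auto
  next
    case 2
    \<comment> \<open>The zero vector counts as spacelike, and unit length rules it out.\<close>
    have T: "causal_sign (T s) = 1" if "s \<in> I" for s
      using 2 unit(1)[OF that] frame(2)[OF that] that
      by (auto simp: spacelike_curve_def spacelike_def causal_sign_def)
    from N show thesis
    proof
      assume "\<forall>s\<in>I. causal_sign (N s) = - 1"
      with 2 T B show thesis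
        by (intro type1)
          (auto simp: spacelike_type1_def timelike_def spacelike_def simp flip: causal_sign_def)
    next
      assume "\<forall>s\<in>I. causal_sign (N s) = 1"
      with 2 T B show thesis
        by (intro type2)
          (auto simp: spacelike_type2_def timelike_def spacelike_def simp flip: causal_sign_def)
    qed
  qed
qed

section \<open>The derivative of X and the evolute condition as a linear system\<close>

text \<open>Product rule and Frenet equations, collected by frame vectors. X' is parallel to T
  exactly when the coefficients of N and B vanish; both directions of the theorem rest on
  this.\<close>

lemma frenet_field_derivative:
  assumes frenet: "frenet_apparatus I \<alpha> T N B \<kappa> \<tau>" and s: "s \<in> I"
    and X: "\<And>s. s \<in> I \<Longrightarrow> X s = v s *\<^sub>R N s + w s *\<^sub>R B s"
    and v: "(v has_real_derivative v') (at s within I)"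
    and w: "(w has_real_derivative w') (at s within I)"
  shows "(X has_vector_derivative (v s * causal_sign (B s) * \<kappa> s) *\<^sub>R T s
           + (v' + causal_sign (T s) * \<tau> s * w s) *\<^sub>R N s + (w' + \<tau> s * v s) *\<^sub>R B s)
         (at s within I)"
proof -
  note N = frenet_apparatusD(4)[OF frenet s] and B = frenet_apparatusD(5)[OF frenet s]
  have "((\<lambda>s. v s *\<^sub>R N s + w s *\<^sub>R B s) has_vector_derivative
      (v s *\<^sub>R ((causal_sign (B s) * \<kappa> s) *\<^sub>R T s + \<tau> s *\<^sub>R B s) + v' *\<^sub>R N s)
      + (w s *\<^sub>R ((causal_sign (T s) * \<tau> s) *\<^sub>R N s) + w' *\<^sub>R B s)) (at s within I)"
    by (intro has_vector_derivative_add has_vector_derivative_scaleR v w N B)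
  then have "(X has_vector_derivative
      (v s *\<^sub>R ((causal_sign (B s) * \<kappa> s) *\<^sub>R T s + \<tau> s *\<^sub>R B s) + v' *\<^sub>R N s)
      + (w s *\<^sub>R ((causal_sign (T s) * \<tau> s) *\<^sub>R N s) + w' *\<^sub>R B s)) (at s within I)"
    by (rule has_vector_derivative_transform[OF s, rotated]) (rule X)
  then show ?thesis
    by (rule back_subst[where P = "\<lambda>D. (X has_vector_derivative D) (at s within I)"])
      (simp add: algebra_simps)
qed

lemma velocity_eq:
  fixes I :: "real set"
  assumes "is_interval I" and "interior I \<noteq> {}" and "s \<in> I"
    and "(\<beta> has_vector_derivative x) (at s within I)"
  shows "velocity I \<beta> s = x"
  unfolding velocity_def
  using assms interval_at_within_neq_bot by (intro vector_derivative_within) auto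

text \<open>For an evolute X' is \<kappa>' T, with \<kappa>' the curvature of \<beta>; comparing
  coefficients with the product rule gives the system, and \<kappa>' being nonzero gives v
  nonzero.\<close>

lemma evolute_direction_curve_imp_derivatives:
  fixes I :: "real set"
  assumes I: "is_interval I" "interior I \<noteq> {}"
    and frenet: "frenet_curve_with I \<alpha> T N B \<kappa> \<tau>"
    and X: "unit_field_along I T N B u v w X"
    and evolute: "evolute_direction_curve I \<alpha> X \<beta>"
    and s: "s \<in> I"
  shows "u s = 0" and "v s \<noteq> 0"
    and "(v has_real_derivative - causal_sign (T s) * \<tau> s * w s) (at s within I)"
    and "(w has_real_derivative - \<tau> s * v s) (at s within I)"
proof -
  from evolute obtain T0 N0 B0 \<kappa>0 \<tau>0 T' N' B' \<kappa>' \<tau>' where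
    \<alpha>: "frenet_curve_with I \<alpha> T0 N0 B0 \<kappa>0 \<tau>0" and \<beta>: "frenet_curve_with I \<beta> T' N' B' \<kappa>' \<tau>'"
    and dir: "direction_curve I X \<beta>"
    and ev: "\<And>s. s \<in> I \<Longrightarrow> lorentz_inner (T' s) (T0 s) = 0" "\<And>s. s \<in> I \<Longrightarrow> N' s = T0 s"
    unfolding evolute_direction_curve_def evolute_of_def by blast
  note fr = frenet_curve_withD(1)[OF frenet] and fr' = frenet_curve_withD(1)[OF \<beta>]
  note frame = frenet_apparatusD(2)[OF fr]
  \<comment> \<open>The frame of \<alpha> witnessing the evolute property may differ from the given
    one, but both tangents are the velocity of \<alpha>, and the condition involves only the
    tangent.\<close>
  have T0: "T0 s = T s" if "s \<in> I" for s
    using frenet_apparatusD(1)[OF frenet_curve_withD(1)[OF \<alpha>] that] frenet_apparatusD(1)[OF fr that]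
    by simp
  have T': "T' s = X s" if "s \<in> I" for s
    using frenet_apparatusD(1)[OF fr' that] velocity_eq[OF I that] dir that
    by (simp add: direction_curve_def)
  have Xeq: "X s = u s *\<^sub>R T s + v s *\<^sub>R N s + w s *\<^sub>R B s" if "s \<in> I" for s
    using X that by (simp add: unit_field_along_def)
  have u0: "u s = 0" if "s \<in> I" for s
  proof -
    have "lorentz_inner (X s) (T s) = 0"
      using ev(1) T0 T' that by metis
    then show ?thesis
      using orthonormal_frameD[OF frame[OF that]] unfolding Xeq[OF that]
      by (auto simp: lorentz_inner_linear causal_sign_def)
  qed
  then show "u s = 0"
    using s .
  have "v differentiable_on I" "w differentiable_on I"
    using X by (simp_all add: unit_field_along_def)
  with s obtain v' w' where v': "(v has_real_derivative v') (at s within I)"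
    and w': "(w has_real_derivative w') (at s within I)"
    unfolding differentiable_on_def real_differentiable_def by metis
  have "(X has_vector_derivative (v s * causal_sign (B s) * \<kappa> s) *\<^sub>R T s
      + (v' + causal_sign (T s) * \<tau> s * w s) *\<^sub>R N s + (w' + \<tau> s * v s) *\<^sub>R B s) (at s within I)"
    using Xeq u0 by (intro frenet_field_derivative[OF fr s _ v' w']) simp
  moreover have "(T' has_vector_derivative \<kappa>' s *\<^sub>R N' s) (at s within I)"
    by (rule frenet_apparatusD(3)[OF fr' s])
  \<comment> \<open>\<open>T'\<close> agrees with \<open>X\<close> only on I, so the derivative is
    transferred within I.\<close>
  then have "(X has_vector_derivative \<kappa>' s *\<^sub>R T s) (at s within I)"
    using T' ev(2) T0 s by (metis (no_types, lifting) has_vector_derivative_transform)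
  ultimately have "(v s * causal_sign (B s) * \<kappa> s) *\<^sub>R T s
      + (v' + causal_sign (T s) * \<tau> s * w s) *\<^sub>R N s + (w' + \<tau> s * v s) *\<^sub>R B s
      = \<kappa>' s *\<^sub>R T s + 0 *\<^sub>R N s + 0 *\<^sub>R B s"
    using vector_derivative_unique_within[OF interval_at_within_neq_bot[OF I s]] by fastforce
  note coeffs = orthonormal_frame_independent[OF frame[OF s] this]
  have "\<kappa>' s \<noteq> 0"
    by (rule frenet_curve_withD(2)[OF \<beta> s])
  with coeffs(1) show "v s \<noteq> 0"
    by auto
  have "v' = - causal_sign (T s) * \<tau> s * w s" "w' = - \<tau> s * v s"
    using coeffs(2,3) by simp_all
  then show "(v has_real_derivative - causal_sign (T s) * \<tau> s * w s) (at s within I)"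
    "(w has_real_derivative - \<tau> s * v s) (at s within I)"
    using v' w' by simp_all
qed

text \<open>
  The equations make \<open>X'\<close> a multiple of \<open>T\<close>, so the principal normal of \<open>\<beta>\<close> is
  \<open>\<plusminus>T\<close> with a constant sign, which reversing the frame of \<open>\<beta>\<close> corrects.
\<close>

lemma derivatives_imp_evolute_direction_curve:
  fixes I :: "real set"
  assumes I: "is_interval I" "interior I \<noteq> {}"
    and frenet: "frenet_curve_with I \<alpha> T N B \<kappa> \<tau>"
    and X: "unit_field_along I T N B u v w X"
    and dir: "direction_curve I X \<beta>"
    and "frenet_curve I \<beta>"
    and u: "\<And>s. s \<in> I \<Longrightarrow> u s = 0"
    and v: "\<And>s. s \<in> I \<Longrightarrow>
      (v has_real_derivative - causal_sign (T s) * \<tau> s * w s) (at s within I)"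
    and w: "\<And>s. s \<in> I \<Longrightarrow> (w has_real_derivative - \<tau> s * v s) (at s within I)"
  shows "evolute_direction_curve I \<alpha> X \<beta>"
proof -
  from \<open>frenet_curve I \<beta>\<close> obtain T' N' B' \<kappa>' \<tau>' where \<beta>: "frenet_curve_with I \<beta> T' N' B' \<kappa>' \<tau>'"
    unfolding frenet_curve_def by blast
  note fr = frenet_curve_withD(1)[OF frenet] and fr' = frenet_curve_withD(1)[OF \<beta>]
  note frame = frenet_apparatusD(2)[OF fr]
  have \<kappa>': "\<kappa>' s \<noteq> 0" if "s \<in> I" for s
    by (rule frenet_curve_withD(2)[OF \<beta> that])
  have Xeq: "X s = v s *\<^sub>R N s + w s *\<^sub>R B s" if "s \<in> I" for s
    using X u that by (simp add: unit_field_along_def)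
  have T': "T' s = X s" if "s \<in> I" for s
    using frenet_apparatusD(1)[OF fr' that] velocity_eq[OF I that] dir that
    by (simp add: direction_curve_def)
  have orth: "lorentz_inner (T' s) (T s) = 0" if "s \<in> I" for s
    using orthonormal_frameD[OF frame[OF that]] unfolding T'[OF that] Xeq[OF that]
    by (simp add: lorentz_inner_linear)
  \<comment> \<open>X' equals both \<kappa>' N' and v \<epsilon>_B \<kappa> T, which dictates this
    factor between N' and T.\<close>
  define c where "c s = v s * causal_sign (B s) * \<kappa> s / \<kappa>' s" for s
  have N': "N' s = c s *\<^sub>R T s" if s: "s \<in> I" for s
  proof -
    have "(X has_vector_derivative (v s * causal_sign (B s) * \<kappa> s) *\<^sub>R T s
        + (- causal_sign (T s) * \<tau> s * w s + causal_sign (T s) * \<tau> s * w s) *\<^sub>R N s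
        + (- \<tau> s * v s + \<tau> s * v s) *\<^sub>R B s) (at s within I)"
      by (intro frenet_field_derivative[OF fr s Xeq v[OF s] w[OF s]])
    then have "(X has_vector_derivative (v s * causal_sign (B s) * \<kappa> s) *\<^sub>R T s) (at s within I)"
      by simp
    moreover have "(T' has_vector_derivative \<kappa>' s *\<^sub>R N' s) (at s within I)"
      by (rule frenet_apparatusD(3)[OF fr' s])
    then have "(X has_vector_derivative \<kappa>' s *\<^sub>R N' s) (at s within I)"
      using T' s by (metis (no_types, lifting) has_vector_derivative_transform)
    ultimately have "\<kappa>' s *\<^sub>R N' s = (v s * causal_sign (B s) * \<kappa> s) *\<^sub>R T s"
      using vector_derivative_unique_within[OF interval_at_within_neq_bot[OF I s]] by blast
    then have "(1 / \<kappa>' s) *\<^sub>R (\<kappa>' s *\<^sub>R N' s) = (1 / \<kappa>' s) *\<^sub>R ((v s * causal_sign (B s) * \<kappa> s) *\<^sub>R T s)"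
      by simp
    then show ?thesis
      using \<kappa>'[OF s] by (simp add: c_def)
  qed
  have "\<bar>c s\<bar> = 1" if "s \<in> I" for s
  proof -
    have "\<bar>causal_sign (N' s)\<bar> = 1" "\<bar>causal_sign (T s)\<bar> = 1"
      using orthonormal_frameD(8)[OF frenet_apparatusD(2)[OF fr' that]]
        orthonormal_frameD(7)[OF frame[OF that]] .
    then have "\<bar>c s\<bar> * \<bar>c s\<bar> = 1"
      by (simp add: N'[OF that] causal_sign_def lorentz_inner_linear abs_mult)
    then show ?thesis
      using abs_square_eq_1[of "c s"] by (auto simp: power2_eq_square)
  qed
  \<comment> \<open>Continuity of both curvatures enters here: a continuous factor with values 1 and
    -1 cannot switch on an interval.\<close>
  moreover have "continuous_on I c"
  proof -
    have "continuous_on I v"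
      using X differentiable_imp_continuous_on by (auto simp: unit_field_along_def)
    moreover have "continuous_on I B"
      using frenet_apparatusD(5)[OF fr] has_vector_derivative_continuous
      unfolding continuous_on_eq_continuous_within by blast
    moreover have "continuous_on I \<kappa>" "continuous_on I \<kappa>'"
      using fr \<beta> by (auto simp: frenet_curve_with_def frenet_apparatus_def)
    ultimately show ?thesis
      unfolding c_def using \<kappa>' by (intro continuous_intros continuous_on_causal_sign) auto
  qed
  ultimately have "(\<forall>s\<in>I. c s = 1) \<or> (\<forall>s\<in>I. c s = - 1)"
    using I(1) by (intro connected_unit_constant) (auto simp: is_interval_connected_1)
  then have "evolute_of I \<alpha> \<beta>"
  proof
    assume "\<forall>s\<in>I. c s = 1"
    with N' orth have "\<forall>s\<in>I. lorentz_inner (T' s) (T s) = 0 \<and> N' s = T s"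
      by simp
    with frenet \<beta> show ?thesis
      unfolding evolute_of_def by blast
  next
    assume "\<forall>s\<in>I. c s = - 1"
    with N' orth have "\<forall>s\<in>I. lorentz_inner (T' s) (T s) = 0 \<and> - N' s = T s"
      by simp
    with frenet frenet_curve_with_flip[OF \<beta>] show ?thesis
      unfolding evolute_of_def by blast
  qed
  with dir show ?thesis
    by (simp add: evolute_direction_curve_def)
qed

section \<open>Circular and hyperbolic systems and their angle functions\<close>

text \<open>Since v is nonzero, w stays strictly between -1 and 1, where arcsin is differentiable.
  The derivative of arcsin w is -\<tau> v / |v|, that is, \<tau> or -\<tau> according to the sign of
  v.\<close>

lemma circular_system_solution:
  fixes v w \<tau> :: "real \<Rightarrow> real"
  assumes I: "connected I"
    and v: "\<And>s. s \<in> I \<Longrightarrow> (v has_real_derivative \<tau> s * w s) (at s within I)"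
    and w: "\<And>s. s \<in> I \<Longrightarrow> (w has_real_derivative - \<tau> s * v s) (at s within I)"
    and unit: "\<And>s. s \<in> I \<Longrightarrow> (v s)\<^sup>2 + (w s)\<^sup>2 = 1"
    and nz: "\<And>s. s \<in> I \<Longrightarrow> v s \<noteq> 0"
  shows "\<exists>\<phi>. antiderivative_on I \<tau> \<phi> \<and> (\<forall>s\<in>I. v s = - cos (\<phi> s) \<and> w s = sin (\<phi> s))"
proof -
  have sqrt: "sqrt (1 - (w s)\<^sup>2) = \<bar>v s\<bar>" if "s \<in> I" for s
    using unit[OF that] by (metis add_diff_cancel_right' real_sqrt_abs)
  have bound: "- 1 < w s" "w s < 1" if "s \<in> I" for s
  proof -
    have "(w s)\<^sup>2 < 1\<^sup>2"
      using unit[OF that] nz[OF that] by (smt (verit) zero_less_power2 one_power2)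
    then show "- 1 < w s" "w s < 1"
      using abs_square_less_1[of "w s"] by auto
  qed
  have arcsin: "((\<lambda>s. arcsin (w s)) has_real_derivative - \<tau> s * v s / \<bar>v s\<bar>) (at s within I)"
    if "s \<in> I" for s
    using DERIV_chain2[OF DERIV_arcsin[OF bound[OF that]] w[OF that]] sqrt[OF that]
    by (simp add: field_simps)
  have "continuous_on I v"
    using v DERIV_continuous unfolding continuous_on_eq_continuous_within by blast
  from connected_nonzero_constant_sign[OF I this nz] show ?thesis
  proof
    assume pos: "\<forall>s\<in>I. v s > 0"
    \<comment> \<open>For positive v the cosine must be negative: reflecting the angle at pi/2 keeps
      the sine, negates the cosine, and turns the derivative -\<tau> into \<tau>.\<close>
    let ?\<phi> = "\<lambda>s. pi - arcsin (w s)"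
    have "antiderivative_on I \<tau> ?\<phi>"
      unfolding antiderivative_on_def
    proof
      fix s assume s: "s \<in> I"
      show "(?\<phi> has_real_derivative \<tau> s) (at s within I)"
        using DERIV_diff[OF DERIV_const arcsin[OF s], of pi] pos s by auto
    qed
    moreover have "v s = - cos (?\<phi> s) \<and> w s = sin (?\<phi> s)" if "s \<in> I" for s
      using bound[OF that] sqrt[OF that] bspec[OF pos that]
      by (simp add: cos_diff sin_diff cos_arcsin)
    ultimately show ?thesis
      by blast
  next
    assume neg: "\<forall>s\<in>I. v s < 0"
    let ?\<phi> = "\<lambda>s. arcsin (w s)"
    have "antiderivative_on I \<tau> ?\<phi>"
      unfolding antiderivative_on_def using arcsin neg by fastforce
    moreover have "v s = - cos (?\<phi> s) \<and> w s = sin (?\<phi> s)" if "s \<in> I" for s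
      using bound[OF that] sqrt[OF that] bspec[OF neg that] by (simp add: cos_arcsin)
    ultimately show ?thesis
      by blast
  qed
qed

lemma circular_solution_derivatives:
  assumes "antiderivative_on I \<tau> \<phi>" and s: "s \<in> I"
    and v: "\<And>s. s \<in> I \<Longrightarrow> v s = - cos (\<phi> s)" and w: "\<And>s. s \<in> I \<Longrightarrow> w s = sin (\<phi> s)"
  shows "(v has_real_derivative \<tau> s * w s) (at s within I)"
    and "(w has_real_derivative - \<tau> s * v s) (at s within I)"
proof -
  have \<phi>: "(\<phi> has_real_derivative \<tau> s) (at s within I)"
    using assms(1) s by (simp add: antiderivative_on_def)
  have "((\<lambda>s. - cos (\<phi> s)) has_real_derivative \<tau> s * w s) (at s within I)"
    "((\<lambda>s. sin (\<phi> s)) has_real_derivative - \<tau> s * v s) (at s within I)"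
    by (auto intro!: derivative_eq_intros \<phi> simp: v w s)
  then show "(v has_real_derivative \<tau> s * w s) (at s within I)"
    "(w has_real_derivative - \<tau> s * v s) (at s within I)"
    \<comment> \<open>The formulas for \<open>v\<close> and \<open>w\<close> hold on all of I, so
      any radius, here 1, serves for the transfer of derivatives.\<close>
    using v w s by (simp_all add: has_field_derivative_transform_within[OF _ zero_less_one s])
qed

text \<open>The sign \<sigma> names the branch of the hyperbola, and reversing N and B of \<alpha>
  exchanges the branches. The system is symmetric in v and w, so the result also applies with their
  roles exchanged.\<close>

lemma hyperbolic_system_solution:
  fixes v w \<tau> :: "real \<Rightarrow> real"
  assumes I: "connected I"
    and v: "\<And>s. s \<in> I \<Longrightarrow> (v has_real_derivative - \<tau> s * w s) (at s within I)"
    and w: "\<And>s. s \<in> I \<Longrightarrow> (w has_real_derivative - \<tau> s * v s) (at s within I)"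
    and unit: "\<And>s. s \<in> I \<Longrightarrow> (v s)\<^sup>2 - (w s)\<^sup>2 = 1"
  shows "\<exists>\<sigma>\<in>{1, -1}. \<exists>\<phi>. antiderivative_on I \<tau> \<phi> \<and>
    (\<forall>s\<in>I. v s = \<sigma> * (- cosh (\<phi> s)) \<and> w s = \<sigma> * sinh (\<phi> s))"
proof -
  have nz: "v s \<noteq> 0" if "s \<in> I" for s
    using unit[OF that] by (smt (verit) zero_le_power2 zero_power2)
  have "continuous_on I v"
    using v DERIV_continuous unfolding continuous_on_eq_continuous_within by blast
  from connected_nonzero_constant_sign[OF I this nz]
  \<comment> \<open>The two alternatives are written as \<sigma> = 1 (v negative) and \<sigma> = -1
    (v positive).\<close>
  have "(\<forall>s\<in>I. \<bar>v s\<bar> = - 1 * v s) \<or> (\<forall>s\<in>I. \<bar>v s\<bar> = - (- 1) * v s)"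
    by auto
  then obtain \<sigma> :: real where \<sigma>: "\<sigma> \<in> {1, -1}" and sgn: "\<And>s. s \<in> I \<Longrightarrow> \<bar>v s\<bar> = - \<sigma> * v s"
    by blast
  have sq: "\<sigma> * \<sigma> = 1" "\<sigma>\<^sup>2 = 1"
    using \<sigma> by auto
  let ?\<phi> = "\<lambda>s. arsinh (\<sigma> * w s)"
  \<comment> \<open>This root is both the denominator in the derivative of arsinh, where it cancels
    v and \<sigma> and leaves \<tau>, and the value of cosh at the angle.\<close>
  have sqrt: "sqrt ((\<sigma> * w s)\<^sup>2 + 1) = - \<sigma> * v s" if "s \<in> I" for s
    unfolding sgn[OF that, symmetric]
    using unit[OF that] sq by (simp add: power_mult_distrib real_sqrt_unique)
  have "antiderivative_on I \<tau> ?\<phi>"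
    unfolding antiderivative_on_def
  proof
    fix s assume s: "s \<in> I"
    have "(?\<phi> has_real_derivative 1 / sqrt ((\<sigma> * w s)\<^sup>2 + 1) * (\<sigma> * (- \<tau> s * v s))) (at s within I)"
      by (intro DERIV_chain2[OF arsinh_real_has_field_derivative] DERIV_cmult w s)
    then show "(?\<phi> has_real_derivative \<tau> s) (at s within I)"
      using nz[OF s] \<sigma> unfolding sqrt[OF s] by auto
  qed
  moreover have "v s = \<sigma> * (- cosh (?\<phi> s)) \<and> w s = \<sigma> * sinh (?\<phi> s)" if "s \<in> I" for s
    using sqrt[OF that] sq by (simp add: cosh_arsinh_real flip: mult.assoc)
  ultimately show ?thesis
    using \<sigma> by blast
qed

lemma hyperbolic_solution_derivatives:
  assumes "antiderivative_on I \<tau> \<phi>" and s: "s \<in> I"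
    and v: "\<And>s. s \<in> I \<Longrightarrow> v s = \<sigma> * (- cosh (\<phi> s))"
    and w: "\<And>s. s \<in> I \<Longrightarrow> w s = \<sigma> * sinh (\<phi> s)"
  shows "(v has_real_derivative - \<tau> s * w s) (at s within I)"
    and "(w has_real_derivative - \<tau> s * v s) (at s within I)"
proof -
  have \<phi>: "(\<phi> has_real_derivative \<tau> s) (at s within I)"
    using assms(1) s by (simp add: antiderivative_on_def)
  have "((\<lambda>s. \<sigma> * (- cosh (\<phi> s))) has_real_derivative - \<tau> s * w s) (at s within I)"
    "((\<lambda>s. \<sigma> * sinh (\<phi> s)) has_real_derivative - \<tau> s * v s) (at s within I)"
    by (auto intro!: derivative_eq_intros \<phi> simp: v w s)
  then show "(v has_real_derivative - \<tau> s * w s) (at s within I)"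
    "(w has_real_derivative - \<tau> s * v s) (at s within I)"
    using v w s by (simp_all add: has_field_derivative_transform_within[OF _ zero_less_one s])
qed

section \<open>The characterisation by causal type\<close>

lemma causal_sign_normal_field:
  assumes "orthonormal_frame t n b"
  shows "causal_sign (p *\<^sub>R n + q *\<^sub>R b) = causal_sign n * p\<^sup>2 + causal_sign b * q\<^sup>2"
  using orthonormal_frameD(3,6)[OF assms]
  by (simp add: causal_sign_def lorentz_inner_linear power2_eq_square)

theorem theorem3p1:
  fixes I :: "real set" and \<alpha> \<beta> T N B X :: "real \<Rightarrow> real^3"
    and \<kappa> \<tau> u v w :: "real \<Rightarrow> real"
  assumes "is_interval I" and "interior I \<noteq> {}"
    and "frenet_curve_with I \<alpha> T N B \<kappa> \<tau>"
    and "unit_field_along I T N B u v w X"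
    and "direction_curve I X \<beta>"
    and "frenet_curve I \<beta>"
  shows "evolute_direction_curve I \<alpha> X \<beta> \<longleftrightarrow>
    (timelike_curve I \<alpha> \<and> spacelike_field I X \<and>
       (\<exists>\<phi>. antiderivative_on I \<tau> \<phi> \<and>
          (\<forall>s\<in>I. u s = 0 \<and> v s = - cos (\<phi> s) \<and> w s = sin (\<phi> s)))) \<or>
    ((spacelike_type1 I \<alpha> T N B \<and> timelike_field I X \<or>
      spacelike_type2 I \<alpha> T N B \<and> spacelike_field I X) \<and>
       (\<exists>\<sigma>\<in>{1, -1}. \<exists>\<phi>. antiderivative_on I \<tau> \<phi> \<and>
          (\<forall>s\<in>I. u s = 0 \<and> v s = \<sigma> * (- cosh (\<phi> s)) \<and> w s = \<sigma> * sinh (\<phi> s)))) \<or>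
    ((spacelike_type1 I \<alpha> T N B \<and> spacelike_field I X \<or>
      spacelike_type2 I \<alpha> T N B \<and> timelike_field I X) \<and>
       (\<exists>\<sigma>\<in>{1, -1}. \<exists>\<phi>. antiderivative_on I \<tau> \<phi> \<and>
          (\<forall>s\<in>I. u s = 0 \<and> v s = \<sigma> * sinh (\<phi> s) \<and> w s = \<sigma> * (- cosh (\<phi> s)))))"
    (is "?E \<longleftrightarrow> ?circ \<or> ?cosh \<or> ?sinh")
proof -
  have conn: "connected I"
    using assms(1) by (simp add: is_interval_connected_1)
  note fr = frenet_curve_withD(1)[OF assms(3)]
  note frame = frenet_apparatusD(2)[OF fr]
  note evoluteI = derivatives_imp_evolute_direction_curve[OF assms]
  have sign_T: "causal_sign (T s) = 1"
    if "spacelike_type1 I \<alpha> T N B \<or> spacelike_type2 I \<alpha> T N B" "s \<in> I" for s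
    using that orthonormal_frameD(7)[OF frame[OF that(2)]]
    by (auto simp: spacelike_type1_def spacelike_type2_def spacelike_def causal_sign_def)
  show ?thesis
  proof
    assume ?E
    note ev = evolute_direction_curve_imp_derivatives[OF assms(1-4) this]
    obtain e where e: "e \<in> {1, -1}"
      and unit: "\<And>s. s \<in> I \<Longrightarrow> causal_sign (N s) * (v s)\<^sup>2 + causal_sign (B s) * (w s)\<^sup>2 = e"
      using assms(4) ev(1) by (auto simp: unit_field_along_def)
    have X: "causal_sign (X s) = e" if "s \<in> I" for s
      using assms(4) ev(1) that unit causal_sign_normal_field[OF frame[OF that]]
      by (simp add: unit_field_along_def)
    have spacelike: "spacelike_field I X" if "e = 1"
      using X that by (simp add: spacelike_field_def spacelike_def flip: causal_sign_def)
    have timelike: "timelike_field I X" if "e = - 1"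
      using X that by (simp add: timelike_field_def timelike_def flip: causal_sign_def)
    obtain s0 where s0: "s0 \<in> I"
      using assms(2) interior_subset by blast
    have cosh_solution: "\<exists>\<sigma>\<in>{1, -1}. \<exists>\<phi>. antiderivative_on I \<tau> \<phi> \<and>
        (\<forall>s\<in>I. v s = \<sigma> * (- cosh (\<phi> s)) \<and> w s = \<sigma> * sinh (\<phi> s))"
      if "\<And>s. s \<in> I \<Longrightarrow> causal_sign (T s) = 1" "\<And>s. s \<in> I \<Longrightarrow> (v s)\<^sup>2 - (w s)\<^sup>2 = 1"
      using ev(3) that(1) by (intro hyperbolic_system_solution[OF conn _ ev(4) that(2)]) fastforce+
    \<comment> \<open>The same hyperbolic system with v and w exchanged.\<close>
    have sinh_solution: "\<exists>\<sigma>\<in>{1, -1}. \<exists>\<phi>. antiderivative_on I \<tau> \<phi> \<and>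
        (\<forall>s\<in>I. w s = \<sigma> * (- cosh (\<phi> s)) \<and> v s = \<sigma> * sinh (\<phi> s))"
      if "\<And>s. s \<in> I \<Longrightarrow> causal_sign (T s) = 1" "\<And>s. s \<in> I \<Longrightarrow> (w s)\<^sup>2 - (v s)\<^sup>2 = 1"
      using ev(3) that(1) by (intro hyperbolic_system_solution[OF conn ev(4) _ that(2)]) fastforce+
    from assms(1) fr show "?circ \<or> ?cosh \<or> ?sinh"
    proof (cases rule: frenet_apparatus_cases)
      case timelike
      \<comment> \<open>For timelike \<alpha> the plane of N and B is positive definite, so X cannot
        be timelike.\<close>
      have "0 \<le> (v s0)\<^sup>2 + (w s0)\<^sup>2"
        by simp
      with timelike(2)[OF s0] unit[OF s0] e have "e = 1"
        by auto
      have "\<exists>\<phi>. antiderivative_on I \<tau> \<phi> \<and> (\<forall>s\<in>I. v s = - cos (\<phi> s) \<and> w s = sin (\<phi> s))"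
      proof (rule circular_system_solution[OF conn _ ev(4) _ ev(2)])
        fix s assume s: "s \<in> I"
        show "(v has_real_derivative \<tau> s * w s) (at s within I)"
          using ev(3)[OF s] timelike(2)[OF s] by simp
        show "(v s)\<^sup>2 + (w s)\<^sup>2 = 1"
          using unit[OF s] timelike(2)[OF s] \<open>e = 1\<close> by simp
      qed
      then show ?thesis
        using timelike(1) spacelike[OF \<open>e = 1\<close>] ev(1) by blast
    next
      case type1
      show ?thesis
      \<comment> \<open>For type 1 the constant e is w^2 - v^2. Thus w carries the cosh when X is
        spacelike, and v when X is timelike.\<close>
      proof (cases "e = 1")
        case True
        have "(w s)\<^sup>2 - (v s)\<^sup>2 = 1" if "s \<in> I" for s
          using unit[OF that] type1(2)[OF that] True by simp
        with sinh_solution type1(2) show ?thesis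
          using type1(1) spacelike[OF True] ev(1) by blast
      next
        case False
        with e have "e = - 1" by simp
        have "(v s)\<^sup>2 - (w s)\<^sup>2 = 1" if "s \<in> I" for s
          using unit[OF that] type1(2)[OF that] \<open>e = - 1\<close> by simp
        with cosh_solution type1(2) show ?thesis
          using type1(1) timelike[OF \<open>e = - 1\<close>] ev(1) by blast
      qed
    next
      case type2
      show ?thesis
      \<comment> \<open>For type 2 the constant e is v^2 - w^2, so the two hyperbolic forms are
        interchanged.\<close>
      proof (cases "e = 1")
        case True
        have "(v s)\<^sup>2 - (w s)\<^sup>2 = 1" if "s \<in> I" for s
          using unit[OF that] type2(2)[OF that] True by simp
        with cosh_solution type2(2) show ?thesis
          using type2(1) spacelike[OF True] ev(1) by blast
      next
        case False
        with e have "e = - 1" by simp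
        have "(w s)\<^sup>2 - (v s)\<^sup>2 = 1" if "s \<in> I" for s
          using unit[OF that] type2(2)[OF that] \<open>e = - 1\<close> by simp
        with sinh_solution type2(2) show ?thesis
          using type2(1) timelike[OF \<open>e = - 1\<close>] ev(1) by blast
      qed
    qed
  next
    assume "?circ \<or> ?cosh \<or> ?sinh"
    then consider (circ) ?circ | (cosh) ?cosh | (sinh) ?sinh
      by blast
    then show ?E
    proof cases
      case circ
      then obtain \<phi> where \<phi>: "antiderivative_on I \<tau> \<phi>"
        and uvw: "\<And>s. s \<in> I \<Longrightarrow> u s = 0" "\<And>s. s \<in> I \<Longrightarrow> v s = - cos (\<phi> s)"
          "\<And>s. s \<in> I \<Longrightarrow> w s = sin (\<phi> s)"
        by blast
      \<comment> \<open>With this sign the general equation v' = -\<epsilon>_T \<tau> w becomes the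
        circular v' = \<tau> w; in the hyperbolic cases the sign 1 gives v' = -\<tau> w.\<close>
      have "causal_sign (T s) = - 1" if "s \<in> I" for s
        using circ frenet_apparatusD(1)[OF fr that] orthonormal_frameD(7)[OF frame[OF that]] that
        by (auto simp: timelike_curve_def timelike_def causal_sign_def)
      then show ?thesis
        using circular_solution_derivatives(1)[OF \<phi> _ uvw(2,3)]
        by (intro evoluteI uvw(1) circular_solution_derivatives(2)[OF \<phi> _ uvw(2,3)]) simp_all
    next
      case cosh
      then obtain \<sigma> \<phi> where \<phi>: "antiderivative_on I \<tau> \<phi>"
        and uvw: "\<And>s. s \<in> I \<Longrightarrow> u s = 0" "\<And>s. s \<in> I \<Longrightarrow> v s = \<sigma> * (- cosh (\<phi> s))"
          "\<And>s. s \<in> I \<Longrightarrow> w s = \<sigma> * sinh (\<phi> s)"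
        by blast
      have "causal_sign (T s) = 1" if "s \<in> I" for s
        using cosh sign_T that by blast
      then show ?thesis
        using hyperbolic_solution_derivatives(1)[OF \<phi> _ uvw(2,3)]
        by (intro evoluteI uvw(1) hyperbolic_solution_derivatives(2)[OF \<phi> _ uvw(2,3)]) simp_all
    next
      case sinh
      then obtain \<sigma> \<phi> where \<phi>: "antiderivative_on I \<tau> \<phi>"
        and uvw: "\<And>s. s \<in> I \<Longrightarrow> u s = 0" "\<And>s. s \<in> I \<Longrightarrow> w s = \<sigma> * (- cosh (\<phi> s))"
          "\<And>s. s \<in> I \<Longrightarrow> v s = \<sigma> * sinh (\<phi> s)"
        by blast
      have "causal_sign (T s) = 1" if "s \<in> I" for s
        using sinh sign_T that by blast
      then show ?thesis
        \<comment> \<open>Here w plays the role of the cosh component, so the two derivative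
          formulas trade places.\<close>
        using hyperbolic_solution_derivatives(2)[OF \<phi> _ uvw(2,3)]
        by (intro evoluteI uvw(1) hyperbolic_solution_derivatives(1)[OF \<phi> _ uvw(2,3)]) simp_all
    qed
  qed
qed

end
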